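(* For every integer $n\ge 1$ with $n\not\equiv 0 \pmod 4$, let $E(n)=F(n)-F_1(n)$ (counted with the weights described in the context). Then $$E(n)=\begin{cases} H(4n), & n\equiv 1,2 \pmod 4,\\ 2H(n), & n\equiv 3\pmod 8,\\ 0, & n\equiv 7 \pmod 8.\end{cases}$$
   Context: A classical binary quadratic form is written $(a,2b,c)$ and denotes $ax^2+2bxy+cy^2$ with $a,b,c\in\mathbb Z$; its determinant is $D=b^2-ac$. Only positive definite forms ($a>0$, $D<0$) are considered, and two forms are equivalent if one is obtained from the other by a change of variables in $SL_2(\mathbb Z)$. The divisor of $(a,2b,c)$ is $\delta=\gcd(a,b,c)$; the form is primitive if $\delta=1$ and derived otherwise. A primitive form $(a,2b,c)$ is uneven if $a$ and $c$ are not both even, and even otherwise; a derived form of divisor $\delta$ is uneven (resp. even) when $(a/\delta,2b/\delta,c/\delta)$ is uneven (resp. even). For $n>0$, $F(n)$ (resp. $F_1(n)$) is the number of equivalence classes of uneven (resp. even) forms, primitive or derived, of determinant $-n$, where each class of $(t,2\cdot 0,t)$ ($t\ge1$, i.e. the class of $(1,2\cdot0,1)$ or derived from it) is counted with weight $1/2$, each class of $(2t,2\cdot t,2t)$ ($t\ge 1$, i.e. the class of $(2,2\cdot1,2)$ or derived from it) is counted with weight $1/3$, and all other classes with weight $1$. For a negative integer $\Delta\equiv 0,1\pmod 4$, $h(\Delta)$ denotes the number of $SL_2(\mathbb Z)$-classes of primitive positive definite forms $ax^2+bxy+cy^2$ with $b^2-4ac=\Delta$; set $h_\omega(\Delta)=h(\Delta)$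 if $\Delta<-4$, $h_\omega(-4)=1/2$, $h_\omega(-3)=1/3$. For such $\Delta$, write $\Delta=f^2\Delta_1$ with $\Delta_1$ a fundamental discriminant and $f\ge1$; the Hurwitz class number is $H(|\Delta|)=\sum_{t\mid f} h_\omega(\Delta/t^2)$. *)

theory Defs
  imports Complex_Main "HOL-Computational_Algebra.Squarefree"
begin

text \<open>A binary quadratic form a x^2 + B x y + c y^2 is represented by the triple (a, B, c).
  A classical form (a, 2b, c) of the paper is the triple (a, 2*b, c) with even middle entry.\<close>
type_synonym bqf = "int \<times> int \<times> int"

text \<open>Change of variables x -> p x + q y, y -> r x + s y.\<close>
definition bqf_act :: "int \<Rightarrow> int \<Rightarrow> int \<Rightarrow> int \<Rightarrow> bqf \<Rightarrow> bqf" where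
  "bqf_act p q r s f = (case f of (a, B, c) \<Rightarrow>
     (a*p^2 + B*p*r + c*r^2,
      2*a*p*q + B*(p*s + q*r) + 2*c*r*s,
      a*q^2 + B*q*s + c*s^2))"

definition bqf_equiv :: "bqf \<Rightarrow> bqf \<Rightarrow> bool" where
  "bqf_equiv f g \<longleftrightarrow> (\<exists>p q r s. p*s - q*r = 1 \<and> g = bqf_act p q r s f)"

definition bqf_classes :: "bqf set \<Rightarrow> bqf set set" where
  "bqf_classes S = S // {(f, g). f \<in> S \<and> g \<in> S \<and> bqf_equiv f g}"

definition classical_forms :: "nat \<Rightarrow> bqf set" where
  "classical_forms n = {(a, B, c). even B \<and> a > 0 \<and> (B div 2)^2 - a*c = - int n}"

definition cdivisor :: "bqf \<Rightarrow> int" where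
  "cdivisor f = (case f of (a, B, c) \<Rightarrow> gcd a (gcd (B div 2) c))"

definition uneven :: "bqf \<Rightarrow> bool" where
  "uneven f = (case f of (a, B, c) \<Rightarrow>
      \<not> (even (a div cdivisor f) \<and> even (c div cdivisor f)))"

definition class_weight :: "bqf set \<Rightarrow> real" where
  "class_weight C =
     (if \<exists>t::int. t \<ge> 1 \<and> (t, 0, t) \<in> C then 1/2
      else if \<exists>t::int. t \<ge> 1 \<and> (2*t, 2*t, 2*t) \<in> C then 1/3
      else 1)"

definition F :: "nat \<Rightarrow> real" where
  "F n = (\<Sum>C\<in>bqf_classes {f \<in> classical_forms n. uneven f}. class_weight C)"

definition F1 :: "nat \<Rightarrow> real" where
  "F1 n = (\<Sum>C\<in>bqf_classes {f \<in> classical_forms n. \<not> uneven f}. class_weight C)"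

definition primitive_forms_disc :: "int \<Rightarrow> bqf set" where
  "primitive_forms_disc D = {(a, b, c). a > 0 \<and> b^2 - 4*a*c = D \<and> gcd a (gcd b c) = 1}"

definition h :: "int \<Rightarrow> nat" where
  "h D = card (bqf_classes (primitive_forms_disc D))"

definition h_omega :: "int \<Rightarrow> real" where
  "h_omega D = (if D = -4 then 1/2 else if D = -3 then 1/3 else real (h D))"

definition fundamental_disc :: "int \<Rightarrow> bool" where
  "fundamental_disc d \<longleftrightarrow>
     (d mod 4 = 1 \<and> squarefree d) \<or>
     (d mod 4 = 0 \<and> ((d div 4) mod 4 = 2 \<or> (d div 4) mod 4 = 3) \<and> squarefree (d div 4))"

definition conductor :: "int \<Rightarrow> int" where
  "conductor D = (THE f. f \<ge> 1 \<and> (\<exists>D1. fundamental_disc D1 \<and> D = f^2 * D1))"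

definition hurwitz :: "nat \<Rightarrow> real" where
  "hurwitz N = (let D = - int N in
     (\<Sum>t\<in>{t. t \<ge> 1 \<and> t dvd conductor D}. h_omega (D div t^2)))"

end

theory Submission
  imports Defs
begin

text \<open>Dividing a form by its content \<open>t\<close> splits \<open>F n\<close> into the class numbers
  \<open>h_omega (-4n/t\<^sup>2)\<close> and \<open>F1 n\<close> into \<open>h_omega (-n/t\<^sup>2)\<close>, with \<open>t\<^sup>2\<close> ranging over the square divisors
  of \<open>n\<close>; the exceptional weights are accounted for by \<open>h(-3) = h(-4) = 1\<close>. Since \<open>4\<close> does not divide
  \<open>n\<close>, the \<open>t\<close> with \<open>t\<^sup>2\<close> dividing \<open>n\<close> are the divisors of the conductor, so these sums are Hurwitz
  class numbers. If \<open>n \<equiv> 1, 2 (mod 4)\<close>, there are no even forms. If \<open>n \<equiv> 3 (mod 4)\<close>, each \<open>d = -n/t\<^sup>2\<close> is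
  odd, and every primitive form of discriminant \<open>4d\<close> is the restriction of a unique primitive form of
  discriminant \<open>d\<close> to a sublattice of index two; counting the sublattices on which the restriction is
  primitive gives \<open>h_omega (4d) = 3 h_omega d\<close> for \<open>d \<equiv> 5 (mod 8)\<close> and \<open>h_omega (4d) = h_omega d\<close> for
  \<open>d \<equiv> 1 (mod 8)\<close>.\<close>

subsection \<open>Action and invariants\<close>

text \<open>Substituting twice multiplies the matrices in the order in which they are applied, so
  this is a right action.\<close>

lemma bqf_act_act:
  "bqf_act p' q' r' s' (bqf_act p q r s f) =
   bqf_act (p*p' + q*r') (p*q' + q*s') (r*p' + s*r') (r*q' + s*s') f"
  by (cases f) (simp add: bqf_act_def algebra_simps power2_eq_square)

lemma bqf_act_id [simp]: "bqf_act 1 0 0 1 f = f"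
  by (cases f) (simp add: bqf_act_def)

lemma bqf_equivI: "p*s - q*r = 1 \<Longrightarrow> bqf_equiv f (bqf_act p q r s f)"
  unfolding bqf_equiv_def by blast

lemma bqf_equiv_refl [simp]: "bqf_equiv f f"
  using bqf_equivI[of 1 1 0 0 f] by simp

lemma bqf_equiv_sym: "bqf_equiv f g \<Longrightarrow> bqf_equiv g f"
proof -
  assume "bqf_equiv f g"
  then obtain p q r s where d: "p*s - q*r = 1" and g: "g = bqf_act p q r s f"
    unfolding bqf_equiv_def by blast
  have "bqf_act s (-q) (-r) p g = bqf_act 1 0 0 1 f"
    unfolding g bqf_act_act using d by (simp add: algebra_simps)
  then have "f = bqf_act s (-q) (-r) p g" by simp
  moreover have "s*p - (-q)*(-r) = 1" using d by (simp add: algebra_simps)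
  ultimately show ?thesis unfolding bqf_equiv_def by blast
qed

lemma bqf_equiv_trans: "bqf_equiv f g \<Longrightarrow> bqf_equiv g k \<Longrightarrow> bqf_equiv f k"
proof -
  assume "bqf_equiv f g" "bqf_equiv g k"
  then obtain p q r s p' q' r' s' where d: "p*s - q*r = 1" "p'*s' - q'*r' = 1"
    and g: "g = bqf_act p q r s f" and k: "k = bqf_act p' q' r' s' g"
    unfolding bqf_equiv_def by blast
  have "(p*p' + q*r') * (r*q' + s*s') - (p*q' + q*s') * (r*p' + s*r') =
      (p*s - q*r) * (p'*s' - q'*r')"
    by (simp add: algebra_simps)
  with d have "(p*p' + q*r') * (r*q' + s*s') - (p*q' + q*s') * (r*p' + s*r') = 1" by simp
  with g k show ?thesis using bqf_act_act unfolding bqf_equiv_def by blast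
qed

lemma bqf_equiv_cong: "bqf_equiv f g \<Longrightarrow> bqf_equiv f k \<longleftrightarrow> bqf_equiv g k"
  using bqf_equiv_sym[of f g] bqf_equiv_trans[of f g k] bqf_equiv_trans[of g f k] by iprover

section \<open>Discriminant, content, positivity and scaling\<close>

definition bqf_disc :: "bqf \<Rightarrow> int" where
  "bqf_disc f = (case f of (a, b, c) \<Rightarrow> b^2 - 4*a*c)"

definition bqf_content :: "bqf \<Rightarrow> int" where
  "bqf_content f = (case f of (a, b, c) \<Rightarrow> gcd a (gcd b c))"

definition bqf_scale :: "int \<Rightarrow> bqf \<Rightarrow> bqf" where
  "bqf_scale t f = (case f of (a, b, c) \<Rightarrow> (t*a, t*b, t*c))"

lemma bqf_disc_act: "bqf_disc (bqf_act p q r s f) = (p*s - q*r)^2 * bqf_disc f"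
  by (cases f) (simp add: bqf_act_def bqf_disc_def algebra_simps power2_eq_square)

lemma bqf_disc_equiv: "bqf_equiv f g \<Longrightarrow> bqf_disc g = bqf_disc f"
  unfolding bqf_equiv_def by (auto simp: bqf_disc_act)

lemma bqf_content_dvd_act: "bqf_content f dvd bqf_content (bqf_act p q r s f)"
proof -
  obtain a b c where f: "f = (a, b, c)" by (cases f)
  define d where "d = gcd a (gcd b c)"
  have d: "d dvd a" "d dvd b" "d dvd c" unfolding d_def by (auto intro: dvd_trans)
  show ?thesis unfolding f bqf_content_def bqf_act_def
    by (simp add: d_def[symmetric] d dvd_add dvd_mult dvd_mult2)
qed

lemma bqf_content_equiv: "bqf_equiv f g \<Longrightarrow> bqf_content g = bqf_content f"
proof -
  assume *: "bqf_equiv f g"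
  have "bqf_content f dvd bqf_content g" "bqf_content g dvd bqf_content f"
    using * bqf_equiv_sym[OF *] bqf_content_dvd_act unfolding bqf_equiv_def by metis+
  then show ?thesis unfolding bqf_content_def by (auto split: prod.splits intro: zdvd_antisym_nonneg)
qed

text \<open>Multiply by \<open>4*a\<close> and complete the square. Since equivalence replaces the
  leading coefficient by a value of the form at a nonzero point, this shows that positivity depends
  only on the class.\<close>

lemma bqf_pos_values:
  fixes a b c x y :: int
  assumes "a > 0" "b^2 - 4*a*c < 0" "x \<noteq> 0 \<or> y \<noteq> 0"
  shows "a*x^2 + b*x*y + c*y^2 > 0"
proof -
  have e: "4*a*(a*x^2 + b*x*y + c*y^2) = (2*a*x + b*y)^2 + (4*a*c - b^2)*y^2"
    by (simp add: algebra_simps power2_eq_square)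
  have "(2*a*x + b*y)^2 + (4*a*c - b^2)*y^2 > 0"
  proof (cases "y = 0")
    case True
    then show ?thesis using assms by simp
  next
    case False
    then have "(4*a*c - b^2)*y^2 > 0" using assms by simp
    then show ?thesis by (simp add: add_nonneg_pos)
  qed
  with e have "4*a*(a*x^2 + b*x*y + c*y^2) > 0" by simp
  with \<open>a > 0\<close> show ?thesis by (simp add: zero_less_mult_iff)
qed

lemma bqf_pos_equiv:
  assumes "bqf_equiv f g" "bqf_disc f < 0" "fst f > 0"
  shows "fst g > 0"
proof -
  obtain a b c where f: "f = (a, b, c)" by (cases f)
  obtain p q r s where d: "p*s - q*r = 1" and g: "g = bqf_act p q r s f"
    using assms unfolding bqf_equiv_def by blast
  have "p \<noteq> 0 \<or> r \<noteq> 0" using d by auto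
  then show ?thesis using bqf_pos_values[of a b c p r] assms
    by (simp add: f g bqf_act_def bqf_disc_def)
qed

lemma primitive_forms_disc_iff:
  "f \<in> primitive_forms_disc d \<longleftrightarrow> fst f > 0 \<and> bqf_disc f = d \<and> bqf_content f = 1"
  by (cases f) (simp add: primitive_forms_disc_def bqf_disc_def bqf_content_def)

lemma primitive_forms_disc_equiv:
  "bqf_equiv f g \<Longrightarrow> d < 0 \<Longrightarrow> f \<in> primitive_forms_disc d \<Longrightarrow> g \<in> primitive_forms_disc d"
  by (simp add: primitive_forms_disc_iff bqf_disc_equiv bqf_content_equiv bqf_pos_equiv)

lemma bqf_act_scale: "bqf_act p q r s (bqf_scale t f) = bqf_scale t (bqf_act p q r s f)"
  by (cases f) (simp add: bqf_act_def bqf_scale_def algebra_simps)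

lemma inj_bqf_scale: "t \<noteq> 0 \<Longrightarrow> inj (bqf_scale t)"
  by (auto simp: inj_def bqf_scale_def)

lemma bqf_equiv_scale_iff:
  "t \<noteq> 0 \<Longrightarrow> bqf_equiv (bqf_scale t f) (bqf_scale t g) \<longleftrightarrow> bqf_equiv f g"
  unfolding bqf_equiv_def bqf_act_scale by (simp add: inj_eq[OF inj_bqf_scale])

lemma bqf_disc_scale: "bqf_disc (bqf_scale t f) = t^2 * bqf_disc f"
  by (cases f) (simp add: bqf_disc_def bqf_scale_def algebra_simps power2_eq_square)

lemma bqf_content_scale: "t \<ge> 0 \<Longrightarrow> bqf_content (bqf_scale t f) = t * bqf_content f"
  by (cases f) (simp add: bqf_content_def bqf_scale_def gcd_mult_distrib_int[symmetric])

subsection \<open>Classes\<close>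

definition bqf_class :: "bqf set \<Rightarrow> bqf \<Rightarrow> bqf set" where
  "bqf_class S f = {g \<in> S. bqf_equiv f g}"

lemma bqf_classes_eq: "bqf_classes S = bqf_class S ` S"
  by (auto simp: bqf_classes_def bqf_class_def quotient_def Image_def)

lemma bqf_class_eq_iff:
  "f \<in> S \<Longrightarrow> g \<in> S \<Longrightarrow> bqf_class S f = bqf_class S g \<longleftrightarrow> bqf_equiv f g"
  unfolding bqf_class_def set_eq_iff mem_Collect_eq
  using bqf_equiv_cong[of f g] bqf_equiv_sym[of g f] bqf_equiv_refl[of g] by metis

text \<open>Serves to count classes through a system of representatives \<open>\<phi> x\<close> with
  an arbitrary index set; the indices may be pairs of a form and a coset.\<close>

lemma bij_betw_bqf_classes:
  assumes "\<And>x. x \<in> X \<Longrightarrow> \<phi> x \<in> S"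
    and "\<And>s. s \<in> S \<Longrightarrow> \<exists>x\<in>X. bqf_equiv s (\<phi> x)"
    and "\<And>x y. x \<in> X \<Longrightarrow> y \<in> X \<Longrightarrow> bqf_equiv (\<phi> x) (\<phi> y) \<Longrightarrow> x = y"
  shows "bij_betw (\<lambda>x. bqf_class S (\<phi> x)) X (bqf_classes S)"
  unfolding bij_betw_def
proof
  show "inj_on (\<lambda>x. bqf_class S (\<phi> x)) X"
    using assms by (auto simp: inj_on_def bqf_class_eq_iff)
  have "bqf_class S s \<in> (\<lambda>x. bqf_class S (\<phi> x)) ` X" if s: "s \<in> S" for s
  proof -
    obtain x where "x \<in> X" "bqf_equiv s (\<phi> x)" using assms(2)[OF s] by blast
    then show ?thesis using bqf_class_eq_iff[OF s assms(1)] by blast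
  qed
  then show "(\<lambda>x. bqf_class S (\<phi> x)) ` X = bqf_classes S"
    unfolding bqf_classes_eq using assms(1) by auto
qed

text \<open>Choose one member of \<open>Q\<close> in each class. The set \<open>Q\<close> allows
  representatives with an extra property, such as an odd leading coefficient.\<close>

lemma bqf_representatives:
  assumes "\<And>f. f \<in> S \<Longrightarrow> \<exists>g\<in>Q. bqf_equiv f g" and "Q \<subseteq> S"
  obtains R where "R \<subseteq> Q" "\<And>f. f \<in> S \<Longrightarrow> \<exists>g\<in>R. bqf_equiv f g"
    "\<And>f g. f \<in> R \<Longrightarrow> g \<in> R \<Longrightarrow> bqf_equiv f g \<Longrightarrow> f = g"
proof -
  define rep where "rep f = (SOME g. g \<in> Q \<and> bqf_equiv f g)" for f
  have rep: "rep f \<in> Q \<and> bqf_equiv f (rep f)" if "f \<in> S" for f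
    unfolding rep_def by (rule someI_ex) (use assms(1)[OF that] in blast)
  \<comment> \<open>Equivalent forms give the same predicate to the choice operator, hence the same
    chosen form.\<close>
  have rep_cong: "rep f = rep g" if "bqf_equiv f g" for f g
  proof -
    show ?thesis unfolding rep_def bqf_equiv_cong[OF that] ..
  qed
  show thesis
  proof (rule that[of "rep ` S"])
    fix f g assume fg: "f \<in> rep ` S" "g \<in> rep ` S" "bqf_equiv f g"
    then obtain f' g' where *: "f' \<in> S" "f = rep f'" "g' \<in> S" "g = rep g'" by blast
    have "bqf_equiv f' f" "bqf_equiv g' g" using rep * by auto
    then have "bqf_equiv f' g'"
      using fg(3) bqf_equiv_sym bqf_equiv_trans by metis
    then show "f = g" using * rep_cong by simp
  qed (use rep in auto)
qed

subsection \<open>Reduction\<close>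

text \<open>Gauss reduction: a translation makes the middle coefficient small, and a swap of the
  variables puts a smaller last coefficient in front. The positive leading coefficient drops with
  each swap, so the process ends.\<close>

lemma bqf_reduce:
  assumes "fst f > 0" "bqf_disc f < 0"
  shows "\<exists>a b c. bqf_equiv f (a, b, c) \<and> 0 < a \<and> \<bar>b\<bar> \<le> a \<and> a \<le> c"
  using assms
proof (induction "nat (fst f)" arbitrary: f rule: less_induct)
  case less
  obtain a b c where f: "f = (a, b, c)" by (cases f)
  have a: "a > 0" using less f by simp
  \<comment> \<open>This \<open>k\<close> turns the middle coefficient into
    \<open>(b + a) mod (2*a) - a\<close>, which lies between \<open>-a\<close> and
    \<open>a\<close>.\<close>
  define k where "k = - ((b + a) div (2*a))"
  define g where "g = bqf_act 1 k 0 1 f"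
  have fg: "bqf_equiv f g" unfolding g_def by (rule bqf_equivI) simp
  obtain c' where g: "g = (a, b + 2*a*k, c')"
    unfolding g_def f bqf_act_def by (simp add: algebra_simps)
  have "b + 2*a*k = (b + a) mod (2*a) - a"
    unfolding k_def using div_mult_mod_eq[of "b+a" "2*a"] by (simp add: algebra_simps)
  then have b: "\<bar>b + 2*a*k\<bar> \<le> a"
    using pos_mod_bound[of "2*a" "b+a"] pos_mod_sign[of "2*a" "b+a"] a by linarith
  show ?case
  proof (cases "a \<le> c'")
    case True
    then show ?thesis using fg g a b by blast
  next
    case False
    define e where "e = bqf_act 0 (-1) 1 0 g"
    have ge: "bqf_equiv g e" unfolding e_def by (rule bqf_equivI) simp
    have fe: "bqf_equiv f e" using fg ge by (rule bqf_equiv_trans)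
    have e1: "fst e = c'" unfolding e_def g bqf_act_def by simp
    have "fst e > 0" "bqf_disc e < 0"
      using bqf_pos_equiv[OF fe] bqf_disc_equiv[OF fe] less by auto
    moreover have "nat (fst e) < nat (fst f)" using False e1 f a by simp
    ultimately obtain a' b' c' where "bqf_equiv e (a', b', c')" "0 < a'" "\<bar>b'\<bar> \<le> a'" "a' \<le> c'"
      using less(1)[of e] by blast
    then show ?thesis using bqf_equiv_trans[OF fe] by blast
  qed
qed

text \<open>From b^2 <= a^2 <= a*c and 4*a*c = b^2 + m follows 3*a*c <= m, which bounds all
  coefficients in terms of \<open>m\<close>.\<close>

lemma primitive_forms_disc_reduce:
  assumes "f \<in> primitive_forms_disc (-m)" "m > 0"
  obtains a b c where "bqf_equiv f (a, b, c)" "(a, b, c) \<in> primitive_forms_disc (-m)"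
    "0 < a" "\<bar>b\<bar> \<le> a" "a \<le> c" "4*(a*c) = b^2 + m" "3*a^2 \<le> m" "3*c \<le> m"
proof -
  have "fst f > 0" "bqf_disc f < 0" using assms by (auto simp: primitive_forms_disc_iff)
  from bqf_reduce[OF this] obtain a b c where
    *: "bqf_equiv f (a, b, c)" "0 < a" "\<bar>b\<bar> \<le> a" "a \<le> c" by blast
  have P: "(a, b, c) \<in> primitive_forms_disc (-m)"
    using primitive_forms_disc_equiv[OF *(1)] assms by simp
  then have d: "4*(a*c) = b^2 + m" by (simp add: primitive_forms_disc_iff bqf_disc_def)
  have "b^2 \<le> a^2" using *(2,3) by (simp add: abs_le_square_iff[symmetric])
  moreover have "a^2 \<le> a*c" using * by (simp add: power2_eq_square)
  ultimately have ac: "3*(a*c) \<le> m" and "3*a^2 \<le> m" using d by linarith+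
  moreover have "1*c \<le> a*c" using * by (intro mult_right_mono) auto
  ultimately show thesis using that[OF *(1) P *(2-4) d] by linarith
qed

lemma finite_bqf_classes_primitive:
  assumes "d < 0"
  shows "finite (bqf_classes (primitive_forms_disc d))"
proof -
  define m where "m = - d"
  let ?B = "{0..m} \<times> {-m..m} \<times> {0..m}"
  have "C \<in> bqf_class (primitive_forms_disc d) ` ?B"
    if C: "C \<in> bqf_classes (primitive_forms_disc d)" for C
  proof -
    obtain f where f: "f \<in> primitive_forms_disc d" "C = bqf_class (primitive_forms_disc d) f"
      using C unfolding bqf_classes_eq by blast
    obtain a b c where *: "bqf_equiv f (a, b, c)" "(a, b, c) \<in> primitive_forms_disc d"
      "0 < a" "\<bar>b\<bar> \<le> a" "a \<le> c" "3*c \<le> m"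
      by (rule primitive_forms_disc_reduce[of f m]) (use f assms m_def in auto)
    have "(a, b, c) \<in> ?B" using * by auto
    moreover have "C = bqf_class (primitive_forms_disc d) (a, b, c)"
      using f * by (simp add: bqf_class_eq_iff)
    ultimately show ?thesis by blast
  qed
  then have "bqf_classes (primitive_forms_disc d) \<subseteq> bqf_class (primitive_forms_disc d) ` ?B"
    by blast
  then show ?thesis by (rule finite_subset) simp
qed

section \<open>Discriminants with a single class\<close>

lemma bqf_classes_single:
  assumes "\<And>f. f \<in> S \<Longrightarrow> bqf_equiv f g" "g \<in> S"
  shows "bqf_classes S = {S}"
proof -
  have "bqf_equiv f f'" if "f \<in> S" "f' \<in> S" for f f'
    using bqf_equiv_trans[OF assms(1)[OF that(1)] bqf_equiv_sym[OF assms(1)[OF that(2)]]] .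
  then have "bqf_class S f = S" if "f \<in> S" for f
    using that unfolding bqf_class_def by blast
  then show ?thesis unfolding bqf_classes_eq using assms(2) by auto
qed

lemma primitive_forms_disc_minus_3:
  "f \<in> primitive_forms_disc (-3) \<Longrightarrow> bqf_equiv f (1, 1, 1)"
proof -
  assume f: "f \<in> primitive_forms_disc (-3)"
  obtain a b c where *: "bqf_equiv f (a, b, c)"
    "0 < a" "\<bar>b\<bar> \<le> a" "a \<le> c" "4*(a*c) = b^2 + 3" "3*a^2 \<le> 3" "3*c \<le> 3"
    by (rule primitive_forms_disc_reduce[OF f]) auto
  then have ac: "a = 1" "c = 1" by linarith+
  then have "b = 0 \<or> b = 1 \<or> b = -1" using * by linarith
  then have "b = 1 \<or> b = -1" using * ac by auto
  \<comment> \<open>The variables of \<open>bqf_equivI\<close> are filled in the order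
    \<open>p\<close>, \<open>s\<close>, \<open>q\<close>, \<open>r\<close>, so this is the
    substitution x -> x + y, y -> y.\<close>
  moreover have "bqf_equiv (1, -1, 1) (1, 1, 1)"
    using bqf_equivI[of 1 1 1 0 "(1, -1, 1)"] by (simp add: bqf_act_def)
  ultimately show ?thesis using *(1) ac bqf_equiv_trans[of f "(1, -1, 1)" "(1, 1, 1)"] by auto
qed

lemma primitive_forms_disc_minus_4:
  "f \<in> primitive_forms_disc (-4) \<Longrightarrow> bqf_equiv f (1, 0, 1)"
proof -
  assume f: "f \<in> primitive_forms_disc (-4)"
  obtain a b c where *: "bqf_equiv f (a, b, c)"
    "0 < a" "\<bar>b\<bar> \<le> a" "a \<le> c" "4*(a*c) = b^2 + 4" "3*a^2 \<le> 4" "3*c \<le> 4"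
    by (rule primitive_forms_disc_reduce[OF f]) auto
  then have "a = 1" "c = 1" by linarith+
  with * show ?thesis by simp
qed

text \<open>Besides (1, 0, 3), reduction leaves only (2, 2, 2) and (2, -2, 2), which have content 2.
  This discriminant is treated by hand because -12 = 4 * (-3), and discriminant -3 has automorphs
  other than plus and minus the identity.\<close>

lemma primitive_forms_disc_minus_12:
  "f \<in> primitive_forms_disc (-12) \<Longrightarrow> bqf_equiv f (1, 0, 3)"
proof -
  assume f: "f \<in> primitive_forms_disc (-12)"
  obtain a b c where *: "bqf_equiv f (a, b, c)" "(a, b, c) \<in> primitive_forms_disc (-12)"
    "0 < a" "\<bar>b\<bar> \<le> a" "a \<le> c" "4*(a*c) = b^2 + 12" "3*a^2 \<le> 12" "3*c \<le> 12"
    by (rule primitive_forms_disc_reduce[OF f]) auto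
  have "a\<^sup>2 \<le> 2\<^sup>2" using * by simp
  then have "a \<le> 2" by (rule power2_le_imp_le) simp
  then have abc: "a \<in> {1, 2}" "b \<in> {-2, -1, 0, 1, 2}" "c \<in> {1, 2, 3, 4}" using * by auto
  have "bqf_content (a, b, c) = 1" using * by (simp add: primitive_forms_disc_iff)
  then have "(a, b, c) = (1, 0, 3)" using abc *(4-6) by (auto simp: bqf_content_def)
  with * show ?thesis by simp
qed

lemma h_unique:
  assumes "\<And>f. f \<in> primitive_forms_disc d \<Longrightarrow> bqf_equiv f g" "g \<in> primitive_forms_disc d"
  shows "h d = 1"
  unfolding h_def using bqf_classes_single[of "primitive_forms_disc d" g] assms by simp

lemma h_minus_12: "h (-12) = 1"
  by (rule h_unique[OF primitive_forms_disc_minus_12])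
     (auto simp: primitive_forms_disc_iff bqf_disc_def bqf_content_def)


subsection \<open>Splitting by content\<close>

lemma bqf_classes_scale:
  assumes "t \<noteq> 0"
  shows "bqf_classes (bqf_scale t ` S) = (`) (bqf_scale t) ` bqf_classes S"
proof -
  have "bqf_class (bqf_scale t ` S) (bqf_scale t f) = bqf_scale t ` bqf_class S f" for f
    unfolding bqf_class_def using bqf_equiv_scale_iff[OF assms] by blast
  then show ?thesis unfolding bqf_classes_eq by (simp add: image_image)
qed

lemma finite_bqf_classes_scale:
  "d < 0 \<Longrightarrow> t \<noteq> 0 \<Longrightarrow> finite (bqf_classes (bqf_scale t ` primitive_forms_disc d))"
  by (simp add: bqf_classes_scale finite_bqf_classes_primitive)

lemma card_bqf_classes_scale:
  assumes "t \<noteq> 0"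
  shows "card (bqf_classes (bqf_scale t ` S)) = card (bqf_classes S)"
  unfolding bqf_classes_scale[OF assms]
  by (intro card_image inj_onI) (simp add: inj_image_eq_iff[OF inj_bqf_scale[OF assms]])

lemma scale_primitive_forms_disc:
  assumes "t > 0" "f \<in> bqf_scale t ` primitive_forms_disc d"
  shows "bqf_content f = t" "bqf_disc f = t^2 * d"
  using assms by (auto simp: primitive_forms_disc_iff bqf_content_scale bqf_disc_scale)

text \<open>The exceptional weights occur exactly where \<open>h_omega\<close> is exceptional, and
  there only one class exists. Evenness of \<open>t\<close> for d = -3 is required because
  \<open>class_weight\<close> recognises multiples of (1, 1, 1) only in the shape
  \<open>(2*s, 2*s, 2*s)\<close>; an odd multiple would get weight 1.\<close>

lemma sum_class_weight_scale:
  assumes "d < 0" "t > 0" "d = -3 \<longrightarrow> even t"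
  shows "(\<Sum>C\<in>bqf_classes (bqf_scale t ` primitive_forms_disc d). class_weight C) = h_omega d"
proof -
  let ?S = "bqf_scale t ` primitive_forms_disc d"
  \<comment> \<open>Comparing contents gives s = t, and comparing discriminants then gives
    \<open>d\<close>; \<open>triangle\<close> is proved in the same way.\<close>
  have square: "d = -4" if s: "s \<ge> 1" "(s, 0, s) \<in> ?S" for s :: int
  proof -
    have "s = t" using scale_primitive_forms_disc(1)[OF \<open>t > 0\<close> s(2)] s(1) by (simp add: bqf_content_def)
    then have "t^2 * d = t^2 * (-4)"
      using scale_primitive_forms_disc(2)[OF \<open>t > 0\<close> s(2)] by (simp add: bqf_disc_def power2_eq_square)
    then show ?thesis using \<open>t > 0\<close> unfolding mult_cancel_left by simp
  qed
  have triangle: "d = -3" if s: "s \<ge> 1" "(2*s, 2*s, 2*s) \<in> ?S" for s :: int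
  proof -
    have "2*s = t" using scale_primitive_forms_disc(1)[OF \<open>t > 0\<close> s(2)] s(1) by (simp add: bqf_content_def)
    then have "t^2 * d = t^2 * (-3)"
      using scale_primitive_forms_disc(2)[OF \<open>t > 0\<close> s(2)] by (auto simp: bqf_disc_def power2_eq_square)
    then show ?thesis using \<open>t > 0\<close> unfolding mult_cancel_left by simp
  qed
  consider "d = -4" | "d = -3" | "d \<noteq> -4" "d \<noteq> -3" by blast
  then show ?thesis
  proof cases
    case 1
    have mem: "(t, 0, t) \<in> ?S"
      by (rule image_eqI[of _ _ "(1, 0, 1)"])
         (auto simp: 1 bqf_scale_def primitive_forms_disc_iff bqf_disc_def bqf_content_def)
    have "bqf_equiv (bqf_scale t f) (t, 0, t)" if "f \<in> primitive_forms_disc d" for f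
      using bqf_equiv_scale_iff[of t f "(1, 0, 1)"] primitive_forms_disc_minus_4[of f] that \<open>t > 0\<close>
      by (simp add: bqf_scale_def 1)
    then have "bqf_classes ?S = {?S}" using mem by (intro bqf_classes_single) blast+
    moreover have "class_weight ?S = 1/2"
      unfolding class_weight_def using mem \<open>t > 0\<close> by (auto intro!: exI[of _ t])
    ultimately show ?thesis by (simp add: h_omega_def 1)
  next
    case 2
    then obtain u where u: "t = 2*u" using assms(3) by blast
    have mem: "(t, t, t) \<in> ?S"
      by (rule image_eqI[of _ _ "(1, 1, 1)"])
         (auto simp: 2 bqf_scale_def primitive_forms_disc_iff bqf_disc_def bqf_content_def)
    have "bqf_equiv (bqf_scale t f) (t, t, t)" if "f \<in> primitive_forms_disc d" for f
      using bqf_equiv_scale_iff[of t f "(1, 1, 1)"] primitive_forms_disc_minus_3[of f] that \<open>t > 0\<close>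
      by (simp add: bqf_scale_def 2)
    then have "bqf_classes ?S = {?S}" using mem by (intro bqf_classes_single) blast+
    moreover have "class_weight ?S = 1/3"
    proof -
      have "\<not> (\<exists>s::int. s \<ge> 1 \<and> (s, 0, s) \<in> ?S)" using square 2 by force
      moreover have "\<exists>s::int. s \<ge> 1 \<and> (2*s, 2*s, 2*s) \<in> ?S"
        using mem \<open>t > 0\<close> unfolding u by (intro exI[of _ u]) simp
      ultimately show ?thesis unfolding class_weight_def by (simp only: if_True if_False)
    qed
    ultimately show ?thesis by (simp add: h_omega_def 2)
  next
    case 3
    have "class_weight C = 1" if "C \<in> bqf_classes ?S" for C
    proof -
      have "C \<subseteq> ?S" using that by (auto simp: bqf_classes_eq bqf_class_def)
      then have "\<not> (\<exists>s::int. s \<ge> 1 \<and> (s, 0, s) \<in> C)" "\<not> (\<exists>s::int. s \<ge> 1 \<and> (2*s, 2*s, 2*s) \<in> C)"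
        using square triangle 3 by blast+
      then show ?thesis unfolding class_weight_def by (simp only: if_False)
    qed
    then show ?thesis using 3 \<open>t > 0\<close> by (simp add: card_bqf_classes_scale h_omega_def h_def)
  qed
qed

text \<open>Equivalence never joins forms from different \<open>S t\<close>, so the classes of the
  union are the disjoint union of the classes of the pieces.\<close>

lemma sum_bqf_classes_UN:
  assumes "finite T" "\<And>t. t \<in> T \<Longrightarrow> finite (bqf_classes (S t))"
    and eq: "\<And>t u f g. t \<in> T \<Longrightarrow> u \<in> T \<Longrightarrow> f \<in> S t \<Longrightarrow> g \<in> S u \<Longrightarrow> bqf_equiv f g \<Longrightarrow> t = u"
  shows "(\<Sum>C\<in>bqf_classes (\<Union>t\<in>T. S t). w C) = (\<Sum>t\<in>T. \<Sum>C\<in>bqf_classes (S t). w C)"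
proof -
  have "bqf_class (\<Union>t\<in>T. S t) f = bqf_class (S t) f" if tf: "t \<in> T" "f \<in> S t" for t f
  proof -
    have "g \<in> S t" if fg: "g \<in> (\<Union>t\<in>T. S t)" "bqf_equiv f g" for g
    proof -
      obtain u where u: "u \<in> T" "g \<in> S u" using fg(1) by blast
      have "t = u" by (rule eq[OF tf(1) u(1) tf(2) u(2) fg(2)])
      then show ?thesis using u by simp
    qed
    then show ?thesis unfolding bqf_class_def using tf(1) by auto
  qed
  then have UN: "bqf_classes (\<Union>t\<in>T. S t) = (\<Union>t\<in>T. bqf_classes (S t))"
    unfolding bqf_classes_eq image_UN by simp
  have disj: "bqf_classes (S t) \<inter> bqf_classes (S u) = {}" if "t \<in> T" "u \<in> T" "t \<noteq> u" for t u
  proof (rule ccontr)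
    assume "bqf_classes (S t) \<inter> bqf_classes (S u) \<noteq> {}"
    then obtain f g where f: "f \<in> S t" "bqf_class (S t) f = bqf_class (S u) g"
      unfolding bqf_classes_eq by blast
    have "f \<in> bqf_class (S t) f" using f(1) by (simp add: bqf_class_def)
    then have "f \<in> S u" unfolding f(2) by (simp add: bqf_class_def)
    with f(1)
    show False using eq[OF \<open>t \<in> T\<close> \<open>u \<in> T\<close>, of f f] \<open>t \<noteq> u\<close> by simp
  qed
  show ?thesis unfolding UN
    by (rule sum.UNION_disjoint) (use assms(1,2) disj in blast)+
qed

section \<open>Possible divisors of a form, and gcd criteria\<close>

definition square_divisors :: "nat \<Rightarrow> int set" where
  "square_divisors n = {t. t \<ge> 1 \<and> t^2 dvd int n}"

lemma finite_square_divisors: "n \<ge> 1 \<Longrightarrow> finite (square_divisors n)"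
proof (rule finite_subset)
  assume "n \<ge> 1"
  show "square_divisors n \<subseteq> {1..int n}"
  proof
    fix t assume t: "t \<in> square_divisors n"
    then have "t dvd int n" unfolding square_divisors_def by (auto elim: dvd_trans[rotated])
    then show "t \<in> {1..int n}" using t \<open>n \<ge> 1\<close> by (auto simp: square_divisors_def dest: zdvd_imp_le)
  qed
qed simp

lemma square_divisors_div:
  assumes "n \<ge> 1" "t \<in> square_divisors n"
  shows "t > 0" "int n = t^2 * (int n div t^2)" "int n div t^2 > 0"
proof -
  show "t > 0" "int n = t^2 * (int n div t^2)" using assms(2) by (auto simp: square_divisors_def)
  then have "t^2 * (int n div t^2) > 0" using assms(1) by linarith
  then show "int n div t^2 > 0" by (simp add: zero_less_mult_iff)
qed

lemma gcd3_divide: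
  fixes a b c :: int
  assumes "a > 0"
  obtains d x y z where "d > 0" "a = d*x" "b = d*y" "c = d*z" "gcd x (gcd y z) = 1"
    "d = gcd a (gcd b c)"
proof -
  define d where "d = gcd a (gcd b c)"
  have "d > 0" using assms unfolding d_def by simp
  have "d dvd a" "d dvd b" "d dvd c" unfolding d_def by (auto intro: dvd_trans)
  then obtain x y z where xyz: "a = d*x" "b = d*y" "c = d*z" by (auto elim!: dvdE)
  have "d = d * gcd x (gcd y z)"
    using d_def \<open>d > 0\<close> unfolding xyz by (simp add: gcd_mult_distrib_int[symmetric])
  then have "gcd x (gcd y z) = 1" using \<open>d > 0\<close> by simp
  then show thesis using that[OF \<open>d > 0\<close> xyz _ d_def] by simp
qed

lemma cdivisor_scale: "t > 0 \<Longrightarrow> cdivisor (t*x, 2*(t*y), t*z) = t * gcd x (gcd y z)"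
  by (simp add: cdivisor_def gcd_mult_distrib_int[symmetric])

text \<open>Translates between two notions of primitivity: a classical form (a, 2b, c) of divisor 1
  is uneven exactly when it is still primitive with its full middle coefficient 2b.\<close>

lemma gcd_double_middle:
  fixes a b c :: int
  shows "gcd a (gcd (2*b) c) = 1 \<longleftrightarrow> gcd a (gcd b c) = 1 \<and> \<not> (even a \<and> even c)"
proof -
  have "gcd a (gcd (2*b) c) = gcd (gcd a c) (2*b)" "gcd a (gcd b c) = gcd (gcd a c) b"
    by (simp_all add: ac_simps)
  then show ?thesis by (auto simp: coprime_iff_gcd_eq_1[symmetric])
qed

text \<open>The counterpart for even forms: (2a, 2b, 2c) has divisor 1 as a classical form exactly
  when its half (a, b, c) is primitive with odd middle coefficient.\<close>

lemma gcd_double_outer: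
  fixes a b c :: int
  shows "gcd (2*a) (gcd b (2*c)) = 1 \<longleftrightarrow> gcd a (gcd b c) = 1 \<and> odd b"
proof -
  have "gcd (2*a) (gcd b (2*c)) = gcd b (gcd (2*a) (2*c))" "gcd a (gcd b c) = gcd b (gcd a c)"
    by (rule gcd.left_commute)+
  moreover have "gcd (2*a) (2*c) = 2 * gcd a c" by (simp add: gcd_mult_left)
  ultimately have "gcd (2*a) (gcd b (2*c)) = gcd b (2 * gcd a c)" "gcd a (gcd b c) = gcd b (gcd a c)"
    by simp_all
  then show ?thesis by (auto simp: coprime_iff_gcd_eq_1[symmetric])
qed

section \<open>Uneven and even forms sorted by divisor\<close>

lemma classical_forms_eq:
  assumes "a > 0"
  shows "(a, 2*b, c) \<in> classical_forms n \<longleftrightarrow> a*c - b^2 = int n"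
  using assms by (auto simp: classical_forms_def)

text \<open>Dividing an uneven form by its divisor \<open>t\<close> leaves (x, 2y, z), of
  discriminant 4(y^2 - xz) = -4n/t^2, and \<open>gcd_double_middle\<close> makes it
  primitive.\<close>

lemma uneven_forms_eq:
  assumes "n \<ge> 1"
  shows "{f \<in> classical_forms n. uneven f} =
    (\<Union>t\<in>square_divisors n. bqf_scale t ` primitive_forms_disc (- 4 * (int n div t^2)))"
    (is "?L = ?R")
proof (intro equalityI subsetI)
  fix f assume f: "f \<in> ?L"
  then obtain a b c where abc: "f = (a, 2*b, c)" "a > 0" "a*c - b^2 = int n"
    by (cases f) (auto simp: classical_forms_def elim!: evenE)
  obtain t x y z where t: "t > 0" "a = t*x" "b = t*y" "c = t*z" "gcd x (gcd y z) = 1"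
    using gcd3_divide[OF abc(2)] by metis
  have n: "int n = t^2 * (x*z - y^2)"
    using abc(3) t by (simp add: algebra_simps power2_eq_square)
  then have T: "t \<in> square_divisors n" using t by (simp add: square_divisors_def)
  have fe: "f = (t*x, 2*(t*y), t*z)" using abc(1) t(2-4) by simp
  have "cdivisor f = t" unfolding fe cdivisor_scale[OF t(1)] t(5) by simp
  then have "uneven f \<longleftrightarrow> \<not> (even x \<and> even z)" using t(1) by (simp add: uneven_def fe)
  then have "\<not> (even x \<and> even z)" using f by blast
  then have "gcd x (gcd (2*y) z) = 1" using t(5) unfolding gcd_double_middle by (rule conjI[rotated])
  moreover have "x > 0" using t abc(2) by (simp add: zero_less_mult_iff)
  moreover have "int n div t^2 = x*z - y^2" using n t(1) by simp
  ultimately have "(x, 2*y, z) \<in> primitive_forms_disc (- 4 * (int n div t^2))"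
    by (simp add: primitive_forms_disc_def)
  moreover have "f = bqf_scale t (x, 2*y, z)" using abc t by (simp add: bqf_scale_def)
  ultimately show "f \<in> ?R" using T by blast
next
  fix f assume "f \<in> ?R"
  then obtain t a B c where t: "t \<in> square_divisors n" and f: "f = bqf_scale t (a, B, c)"
    and P: "a > 0" "B^2 - 4*a*c = - 4 * (int n div t^2)" "gcd a (gcd B c) = 1"
    by (auto simp: primitive_forms_disc_def)
  have "B^2 = 2 * (2 * (a*c - int n div t^2))" using P(2) by (simp add: algebra_simps)
  then have "even (B^2)" by simp
  then obtain b where b: "B = 2*b" by auto
  note td = square_divisors_div[OF assms t]
  have "a*c - b^2 = int n div t^2" using P(2) unfolding b by (simp add: power2_eq_square)
  then have "int n = t^2 * (a*c - b^2)" using td by simp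
  then have "(t*a)*(t*c) - (t*b)^2 = int n" by (simp add: algebra_simps power2_eq_square)
  moreover have fe: "f = (t*a, 2*(t*b), t*c)" by (simp add: f b bqf_scale_def)
  ultimately have "f \<in> classical_forms n"
    using td P unfolding fe by (subst classical_forms_eq) auto
  moreover have "uneven f"
    unfolding fe uneven_def using cdivisor_scale[of t a b c] td P b gcd_double_middle[of a b c] by simp
  ultimately show "f \<in> ?L" by blast
qed

text \<open>After division by the divisor \<open>t\<close> an even form is still twice an integral
  form (u, y, v), of discriminant y^2 - 4uv = -n/t^2; hence the scale factor
  \<open>2*t\<close>.\<close>

lemma even_forms_eq:
  assumes "n \<ge> 1" "n mod 4 \<noteq> 0"
  shows "{f \<in> classical_forms n. \<not> uneven f} =
    (\<Union>t\<in>square_divisors n. bqf_scale (2*t) ` primitive_forms_disc (- (int n div t^2)))"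
    (is "?L = ?R")
proof (intro equalityI subsetI)
  fix f assume f: "f \<in> ?L"
  then obtain a b c where abc: "f = (a, 2*b, c)" "a > 0" "a*c - b^2 = int n"
    by (cases f) (auto simp: classical_forms_def elim!: evenE)
  obtain t x y z where t: "t > 0" "a = t*x" "b = t*y" "c = t*z" "gcd x (gcd y z) = 1"
    using gcd3_divide[OF abc(2)] by metis
  have n: "int n = t^2 * (x*z - y^2)"
    using abc(3) t by (simp add: algebra_simps power2_eq_square)
  then have T: "t \<in> square_divisors n" using t by (simp add: square_divisors_def)
  have fe: "f = (t*x, 2*(t*y), t*z)" using abc(1) t(2-4) by simp
  have "cdivisor f = t" unfolding fe cdivisor_scale[OF t(1)] t(5) by simp
  then have "uneven f \<longleftrightarrow> \<not> (even x \<and> even z)" using t(1) by (simp add: uneven_def fe)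
  then have "even x \<and> even z" using f by blast
  then obtain u v where uv: "x = 2*u" "z = 2*v" by blast
  have "gcd u (gcd y v) = 1" using t(5) unfolding uv gcd_double_outer by simp
  moreover have "u > 0" using t abc(2) uv by (simp add: zero_less_mult_iff)
  moreover have "int n div t^2 = 4*u*v - y^2" using n t(1) uv by simp
  ultimately have "(u, y, v) \<in> primitive_forms_disc (- (int n div t^2))"
    by (simp add: primitive_forms_disc_def)
  moreover have "f = bqf_scale (2*t) (u, y, v)" using abc t uv by (simp add: bqf_scale_def)
  ultimately show "f \<in> ?R" using T by blast
next
  fix f assume "f \<in> ?R"
  then obtain t a b c where t: "t \<in> square_divisors n" and f: "f = bqf_scale (2*t) (a, b, c)"
    and P: "a > 0" "b^2 - 4*a*c = - (int n div t^2)" "gcd a (gcd b c) = 1"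
    by (auto simp: primitive_forms_disc_def)
  note td = square_divisors_div[OF assms(1) t]
  have "4*a*c - b^2 = int n div t^2" using P(2) by linarith
  then have n: "int n = t^2 * (4*a*c - b^2)" by (rule ssubst) (rule td(2))
  \<comment> \<open>An even \<open>b\<close> would make \<open>n\<close> divisible by 4. Oddness
    ensures that the divisor of \<open>f\<close> is \<open>t\<close> and not
    \<open>2*t\<close>.\<close>
  have "odd b"
  proof
    assume "even b"
    then obtain k where "b = 2*k" by blast
    then have "int n = 4 * (t^2 * (a*c - k^2))" using n by (simp add: algebra_simps power2_eq_square)
    then have "4 dvd int n" by simp
    then show False using assms(2) by presburger
  qed
  then have g: "gcd (2*a) (gcd b (2*c)) = 1" using P(3) unfolding gcd_double_outer by simp
  have "(t*(2*a))*(t*(2*c)) - (t*b)^2 = int n" unfolding n by (simp add: algebra_simps power2_eq_square)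
  moreover have fe: "f = (t*(2*a), 2*(t*b), t*(2*c))" by (simp add: f bqf_scale_def)
  ultimately have "f \<in> classical_forms n"
    using td P unfolding fe by (subst classical_forms_eq) auto
  moreover have "\<not> uneven f"
    unfolding fe uneven_def using cdivisor_scale[of t "2*a" b "2*c"] td g by simp
  ultimately show "f \<in> ?L" by blast
qed

lemma F_eq:
  assumes "n \<ge> 1"
  shows "F n = (\<Sum>t\<in>square_divisors n. h_omega (- 4 * (int n div t^2)))"
proof -
  let ?S = "\<lambda>t. bqf_scale t ` primitive_forms_disc (- 4 * (int n div t^2))"
  note td = square_divisors_div[OF assms]
  have "F n = (\<Sum>t\<in>square_divisors n. \<Sum>C\<in>bqf_classes (?S t). class_weight C)"
    unfolding F_def uneven_forms_eq[OF assms]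
  proof (rule sum_bqf_classes_UN)
    show "finite (bqf_classes (?S t))" if "t \<in> square_divisors n" for t
      using td[OF that] by (intro finite_bqf_classes_scale) auto
    show "t = u" if "t \<in> square_divisors n" "u \<in> square_divisors n" "f \<in> ?S t" "g \<in> ?S u" "bqf_equiv f g"
      for t u f g
      using bqf_content_equiv[OF that(5)] scale_primitive_forms_disc(1)[OF td(1)[OF that(1)] that(3)]
        scale_primitive_forms_disc(1)[OF td(1)[OF that(2)] that(4)] by simp
  qed (rule finite_square_divisors[OF assms])
  also have "\<dots> = (\<Sum>t\<in>square_divisors n. h_omega (- 4 * (int n div t^2)))"
  proof (rule sum.cong)
    fix t assume t: "t \<in> square_divisors n"
    \<comment> \<open>Here the scale factor \<open>t\<close> may be odd, so discriminant -3 has to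
      be ruled out before \<open>sum_class_weight_scale\<close> applies.\<close>
    have minus_3: "- 4 * (int n div t^2) \<noteq> -3"
    proof
      assume "- 4 * (int n div t^2) = -3"
      then have "4 dvd (3::int)" by (intro dvdI[of _ _ "int n div t^2"]) simp
      then show False by simp
    qed
    show "(\<Sum>C\<in>bqf_classes (?S t). class_weight C) = h_omega (- 4 * (int n div t^2))"
      using td[OF t] minus_3 by (intro sum_class_weight_scale) auto
  qed simp
  finally show ?thesis .
qed

text \<open>Discriminant -3 can occur here, but the scale factor \<open>2*t\<close> is even, so its
  class has weight 1/3 as \<open>h_omega\<close> demands.\<close>

lemma F1_eq:
  assumes "n \<ge> 1" "n mod 4 \<noteq> 0"
  shows "F1 n = (\<Sum>t\<in>square_divisors n. h_omega (- (int n div t^2)))"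
proof -
  let ?S = "\<lambda>t. bqf_scale (2*t) ` primitive_forms_disc (- (int n div t^2))"
  note td = square_divisors_div[OF assms(1)]
  have td2: "2*t > 0" if "t \<in> square_divisors n" for t using td(1)[OF that] by simp
  have "F1 n = (\<Sum>t\<in>square_divisors n. \<Sum>C\<in>bqf_classes (?S t). class_weight C)"
    unfolding F1_def even_forms_eq[OF assms]
  proof (rule sum_bqf_classes_UN)
    show "finite (bqf_classes (?S t))" if "t \<in> square_divisors n" for t
      using td[OF that] by (intro finite_bqf_classes_scale) auto
    show "t = u" if "t \<in> square_divisors n" "u \<in> square_divisors n" "f \<in> ?S t" "g \<in> ?S u" "bqf_equiv f g"
      for t u f g
      using bqf_content_equiv[OF that(5)] scale_primitive_forms_disc(1)[OF td2[OF that(1)] that(3)]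
        scale_primitive_forms_disc(1)[OF td2[OF that(2)] that(4)] by simp
  qed (rule finite_square_divisors[OF assms(1)])
  also have "\<dots> = (\<Sum>t\<in>square_divisors n. h_omega (- (int n div t^2)))"
  proof (rule sum.cong)
    fix t assume t: "t \<in> square_divisors n"
    show "(\<Sum>C\<in>bqf_classes (?S t). class_weight C) = h_omega (- (int n div t^2))"
      using td[OF t] by (intro sum_class_weight_scale) auto
  qed simp
  finally show ?thesis .
qed


subsection \<open>Discriminants multiplied by four\<close>

text \<open>Automorphs of a primitive form correspond to solutions of the Pell equation v^2 - d*u^2
  = 4, which has only u = 0, v = 2 or v = -2 when d < -4.\<close>

lemma bqf_primitive_automorph:
  assumes f: "f \<in> primitive_forms_disc d" and "d < -4"
    and det: "p*s - q*r = 1" and fixed: "bqf_act p q r s f = f"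
  shows "q = 0 \<and> r = 0 \<and> s = p \<and> (p = 1 \<or> p = -1)"
proof -
  obtain a b c where abc: "f = (a, b, c)" by (cases f)
  have a: "a > 0" and d: "b^2 - 4*a*c = d" and g: "gcd a (gcd b c) = 1"
    using f by (auto simp: abc primitive_forms_disc_def)
  have 1: "a*p^2 + b*p*r + c*r^2 = a" and 2: "2*a*p*q + b*(p*s + q*r) + 2*c*r*s = b"
    and 3: "a*q^2 + b*q*s + c*s^2 = c"
    using fixed by (auto simp: abc bqf_act_def)
  \<comment> \<open>With G the symmetric matrix of the form and M that of the automorph, M^T G M = G
    reads M^T G = G M^(-1). The first column of this identity gives the linear relations
    \<open>sp\<close> and \<open>q\<close>.\<close>
  have "(p*s - q*r) * (2*a*p + b*r) =
      s * (2 * (a*p^2 + b*p*r + c*r^2)) - r * (2*a*p*q + b*(p*s + q*r) + 2*c*r*s)"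
    by (simp add: algebra_simps power2_eq_square)
  then have sp: "a*(s - p) = b*r" unfolding 1 2 det by (simp add: algebra_simps)
  have "(p*s - q*r) * (2*a*q + b*s) =
      s * (2*a*p*q + b*(p*s + q*r) + 2*c*r*s) - r * (2 * (a*q^2 + b*q*s + c*s^2))"
    by (simp add: algebra_simps power2_eq_square)
  then have q: "a*q = - (c*r)" unfolding 2 3 det by (simp add: algebra_simps)
  \<comment> \<open>Primitivity enters here: \<open>a\<close> divides \<open>r*b\<close> and
    \<open>r*c\<close> and is coprime to \<open>gcd b c\<close>, so it divides
    \<open>r\<close>.\<close>
  have "a dvd r*b" using dvd_triv_left[of a "s - p"] unfolding sp by (simp add: mult.commute)
  moreover have "a dvd r*c" using dvd_triv_left[of a q] unfolding q by (simp add: mult.commute)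
  ultimately have "a dvd gcd (r*b) (r*c)" by simp
  then have "a dvd \<bar>r\<bar> * gcd b c" by (simp only: gcd_mult_distrib_int)
  moreover have "coprime a (gcd b c)" using g by (simp add: coprime_iff_gcd_eq_1)
  ultimately have "a dvd r" by (simp add: coprime_dvd_mult_left_iff)
  then obtain u where r: "r = a*u" by blast
  have "a*(s - p) = a*(b*u)" using sp r by simp
  then have s: "s = p + b*u" using a by simp
  have "a*q = a*(- (c*u))" using q r by simp
  then have q': "q = - (c*u)" using a unfolding mult_cancel_left by simp
  \<comment> \<open>The determinant condition becomes the Pell equation, with v = 2p + bu.\<close>
  have "4 * (p*s - q*r) = (2*p + b*u)^2 + (-d) * u^2"
    unfolding r s q' d[symmetric] by (simp add: algebra_simps power2_eq_square)
  then have e: "(2*p + b*u)^2 + (-d) * u^2 = 4" using det by simp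
  have "u = 0"
  proof (rule ccontr)
    assume "u \<noteq> 0"
    then have "u^2 \<ge> 1" using zero_less_power2[of u] by linarith
    then have "(-d) * 1 \<le> (-d) * u^2" using \<open>d < -4\<close> by (intro mult_left_mono) auto
    then show False using e \<open>d < -4\<close> zero_le_power2[of "2*p + b*u"] by linarith
  qed
  moreover from this have "p*p = 1" using det r s q' by simp
  then have "p = 1 \<or> p = -1" by (simp add: zmult_eq_1_iff)
  ultimately show ?thesis using r s q' by simp
qed

text \<open>The form \<open>f(x, 2y)\<close>, i.e. the restriction of \<open>f\<close> to a sublattice of index two.\<close>
definition bqf_double :: "bqf \<Rightarrow> bqf" where
  "bqf_double f = (case f of (a, b, c) \<Rightarrow> (a, 2*b, 4*c))"

text \<open>Doubling is the action of diag(1, 2), and conjugation by it moves the factor 2 from the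
  lower left entry to the upper right one.\<close>

lemma bqf_double_act:
  "bqf_double (bqf_act p q (2*r) s f) = bqf_act p (2*q) r s (bqf_double f)"
  by (cases f) (simp add: bqf_double_def bqf_act_def algebra_simps power2_eq_square)

lemma bqf_double_equivI:
  assumes "p*s - q*r = 1" "even r"
  shows "bqf_equiv (bqf_double f) (bqf_double (bqf_act p q r s f))"
proof -
  obtain r' where r: "r = 2*r'" using assms(2) by blast
  have "p*s - (2*q)*r' = 1" using assms(1) unfolding r by simp
  then show ?thesis unfolding r bqf_double_act by (rule bqf_equivI)
qed

text \<open>The last coefficients modulo 2 force the upper right entry of the matrix to be even, so
  the conjugation in \<open>bqf_double_act\<close> can be undone.\<close>

lemma bqf_double_equivD:
  assumes "bqf_equiv (bqf_double f) (bqf_double g)" "odd (fst f)"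
  obtains p q r s where "p*s - q*r = 1" "even r" "g = bqf_act p q r s f"
proof -
  obtain a b c where f: "f = (a, b, c)" by (cases f)
  obtain a' b' c' where g: "g = (a', b', c')" by (cases g)
  obtain p q r s where det: "p*s - q*r = 1" and
    e: "bqf_double g = bqf_act p q r s (bqf_double f)"
    using assms(1) unfolding bqf_equiv_def by blast
  have "4*c' = a*q^2 + 2*b*q*s + 4*c*s^2"
    using e by (simp add: f g bqf_double_def bqf_act_def)
  then have "a*q^2 = 2 * (2*c' - b*q*s - 2*c*s^2)" by (simp add: algebra_simps)
  then have "even (a*q^2)" by simp
  then have "even q" using assms(2) f by simp
  then obtain q' where q: "q = 2*q'" by blast
  have "bqf_double g = bqf_double (bqf_act p q' (2*r) s f)"
    unfolding bqf_double_act e q ..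
  then have "g = bqf_act p q' (2*r) s f" by (auto simp: bqf_double_def split: prod.splits)
  moreover have "p*s - q'*(2*r) = 1" using det q by simp
  ultimately show thesis using that[of p s q' "2*r"] by simp
qed

text \<open>Passing from b, c to 2b, 4c can only add powers of two to the content, and does so
  exactly when \<open>a\<close> is even.\<close>

lemma bqf_double_primitive_iff:
  "bqf_double f \<in> primitive_forms_disc (4*d) \<longleftrightarrow> f \<in> primitive_forms_disc d \<and> odd (fst f)"
proof -
  obtain a b c where f: "f = (a, b, c)" by (cases f)
  have "gcd a (gcd (2*b) (4*c)) = 1 \<longleftrightarrow> gcd a (gcd b c) = 1 \<and> odd a"
  proof
    assume *: "gcd a (gcd (2*b) (4*c)) = 1"
    have "gcd a (gcd b c) dvd gcd a (gcd (2*b) (4*c))"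
      by (auto intro: dvd_trans[of _ "gcd b c"] dvd_mult)
    moreover have "odd a"
    proof
      assume "even a"
      then have "2 dvd gcd a (gcd (2*b) (4*c))" by simp
      then show False unfolding * by simp
    qed
    ultimately show "gcd a (gcd b c) = 1 \<and> odd a" using * by simp
  next
    assume *: "gcd a (gcd b c) = 1 \<and> odd a"
    define g where "g = gcd a (gcd (2*b) (4*c))"
    have g: "g dvd a" "g dvd 2*b" "g dvd 4*c"
      unfolding g_def by (auto intro: dvd_trans[of _ "gcd (2*b) (4*c)"])
    then have "odd g" using * by (meson dvd_trans)
    then have "coprime g 2" by simp
    then have "coprime g (2^2)" unfolding coprime_power_right_iff by simp
    then have "g dvd b" "g dvd c"
      using g \<open>coprime g 2\<close> by (simp_all add: coprime_dvd_mult_right_iff)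
    then have "g dvd gcd a (gcd b c)" using g by simp
    then show "gcd a (gcd (2*b) (4*c)) = 1" using * unfolding g_def by simp
  qed
  then show ?thesis
    by (auto simp: f bqf_double_def primitive_forms_disc_def power2_eq_square)
qed

lemma odd_square_mod_8: "odd (x::int) \<Longrightarrow> x^2 mod 8 = 1"
proof -
  assume "odd x"
  then obtain k where "x = 2*k + 1" by (rule oddE)
  then have "x^2 = 4*(k*(k+1)) + 1" by (simp add: algebra_simps power2_eq_square)
  moreover have "even (k*(k+1))" by simp
  then obtain m where "k*(k+1) = 2*m" by blast
  ultimately have "x^2 = 8*m + 1" by simp
  then show ?thesis by presburger
qed

text \<open>Modulo 2 the form is the square of a nonzero linear form, so some equivalent form has
  odd first and even last coefficient. As d is 1 modulo 4, the last one is then divisible by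
  4.\<close>

lemma bqf_double_surj:
  assumes "d mod 4 = 1" "d < 0" "G \<in> primitive_forms_disc (4*d)"
  obtains g where "g \<in> primitive_forms_disc d" "odd (fst g)" "bqf_equiv G (bqf_double g)"
proof -
  obtain a B c where abc: "G = (a, B, c)" by (cases G)
  have disc: "B^2 = 4*(a*c + d)" and g: "gcd a (gcd B c) = 1"
    using assms(3) by (auto simp: abc primitive_forms_disc_def)
  have "even (B^2)" unfolding disc by simp
  then obtain b where b: "B = 2*b" by auto
  have d: "b^2 = a*c + d" using disc by (simp add: b)
  \<comment> \<open>Here b' is odd, so b'^2 and \<open>d\<close> agree modulo 4 and 4 divides a'c',
    with a' odd.\<close>
  have mid_dvd: "4 dvd c'" if "odd a'" "even c'" "b'^2 = a'*c' + d" for a' b' c' :: int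
  proof -
    have "even (a'*c')" using that by simp
    moreover have "odd d" using assms(1) by presburger
    ultimately have "odd (b'^2)" using that(3) by simp
    then have "b'^2 mod 8 = 1" using odd_square_mod_8 by simp
    moreover have "4 dvd y" if "x mod 8 = 1" "x = y + d" for x y :: int
      using that assms(1) by presburger
    ultimately have "4 dvd a'*c'" using that(3) by blast
    moreover have "coprime (2^2) a'" using that(1) by (simp only: coprime_power_left_iff) simp
    ultimately show ?thesis by (simp add: coprime_dvd_mult_right_iff)
  qed
  have "\<not> (even a \<and> even c)"
  proof
    assume "even a \<and> even c"
    then have "2 dvd gcd a (gcd B c)" by (simp add: b)
    then show False unfolding g by simp
  qed
  then consider "odd a" "even c" | "even a" "odd c" | "odd a" "odd c" by blast
  then have "\<exists>a' b' c'. bqf_equiv G (a', 2*b', c') \<and> odd a' \<and> even c'"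
  proof cases
    case 1
    then show ?thesis using abc b bqf_equiv_refl by blast
  next
    case 2
    have "bqf_equiv G (c, 2*(-b), a)"
      using bqf_equivI[of 0 0 "-1" 1 G] by (simp add: abc b bqf_act_def)
    with 2 show ?thesis by blast
  next
    case 3
    have "odd d" using assms(1) by presburger
    then have "even b" using d 3 by (metis even_add even_mult_iff even_power zero_less_numeral)
    have "bqf_equiv G (a, 2*(a + b), a + 2*b + c)"
      using bqf_equivI[of 1 1 1 0 G] by (simp add: abc b bqf_act_def algebra_simps)
    moreover have "even (a + 2*b + c)" using 3 by simp
    ultimately show ?thesis using 3 by blast
  qed
  then obtain a' b' c' where e: "bqf_equiv G (a', 2*b', c')" "odd a'" "even c'" by blast
  have P: "(a', 2*b', c') \<in> primitive_forms_disc (4*d)"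
    using primitive_forms_disc_equiv[OF e(1)] assms by simp
  then have "b'^2 = a'*c' + d" by (simp add: primitive_forms_disc_def)
  then obtain k where "c' = 4*k" using mid_dvd e by blast
  then have eq: "(a', 2*b', c') = bqf_double (a', b', k)" by (simp add: bqf_double_def)
  show thesis
    using that[of "(a', b', k)"] e P unfolding eq bqf_double_primitive_iff by blast
qed

lemma h_eq_card:
  assumes "\<And>x. x \<in> X \<Longrightarrow> \<phi> x \<in> primitive_forms_disc d"
    and "\<And>f. f \<in> primitive_forms_disc d \<Longrightarrow> \<exists>x\<in>X. bqf_equiv f (\<phi> x)"
    and "\<And>x y. x \<in> X \<Longrightarrow> y \<in> X \<Longrightarrow> bqf_equiv (\<phi> x) (\<phi> y) \<Longrightarrow> x = y"
  shows "h d = card X"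
  unfolding h_def using bij_betw_same_card[OF bij_betw_bqf_classes[OF assms]] by simp

text \<open>Modulo 2 the form is \<open>x\<^sup>2 + x y\<close> up to equivalence, so exactly one of the three sublattices
  of index two carries a primitive restriction.\<close>
lemma h_four_mult_1_mod_8:
  assumes "d mod 8 = 1" "d < 0"
  shows "h (4*d) = h d"
proof -
  let ?P = "primitive_forms_disc d"
  have d4: "d mod 4 = 1" using assms(1) by presburger
  \<comment> \<open>Both b^2 and \<open>d\<close> are 1 modulo 8, so 4ac is divisible by 8.\<close>
  have parity: "odd b \<and> even (a*c)" if "(a, b, c) \<in> ?P" for a b c
  proof -
    have e: "b^2 = 4*(a*c) + d" using that by (simp add: primitive_forms_disc_def)
    moreover have "odd d" using assms(1) by presburger
    ultimately have "odd (b^2)" by simp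
    then have "b^2 mod 8 = 1" using odd_square_mod_8 by simp
    moreover have "even y" if "x mod 8 = 1" "x = 4*y + d" for x y :: int
      using that assms(1) by presburger
    ultimately have "even (a*c)" using e by blast
    then show ?thesis using \<open>odd (b^2)\<close> by simp
  qed
  \<comment> \<open>One of the values at (1, 0), (0, 1), (1, 1) is odd, because a + b + c is odd
    when \<open>a\<close> and \<open>c\<close> are even.\<close>
  have "\<exists>g\<in>{f \<in> ?P. odd (fst f)}. bqf_equiv f g" if f: "f \<in> ?P" for f
  proof -
    obtain a b c where abc: "f = (a, b, c)" by (cases f)
    consider "odd a" | "even a" "odd c" | "even a" "even c" by blast
    then obtain g where "bqf_equiv f g" "odd (fst g)"
    proof cases
      case 1
      then show thesis using that[of f] abc by simp
    next
      case 2
      then show thesis using that[OF bqf_equivI[of 0 0 "-1" 1 f]] by (simp add: abc bqf_act_def)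
    next
      case 3
      then show thesis using that[OF bqf_equivI[of 1 1 0 1 f]] parity f by (simp add: abc bqf_act_def)
    qed
    then show ?thesis using primitive_forms_disc_equiv[OF _ assms(2) f] by blast
  qed
  then obtain R where R: "R \<subseteq> {f \<in> ?P. odd (fst f)}" "\<And>f. f \<in> ?P \<Longrightarrow> \<exists>g\<in>R. bqf_equiv f g"
    "\<And>f g. f \<in> R \<Longrightarrow> g \<in> R \<Longrightarrow> bqf_equiv f g \<Longrightarrow> f = g"
    using bqf_representatives[of ?P "{f \<in> ?P. odd (fst f)}"] by blast
  have "h d = card R" using h_eq_card[of R id d] R by auto
  moreover have "h (4*d) = card R"
  proof (rule h_eq_card[of R bqf_double])
    show "bqf_double f \<in> primitive_forms_disc (4*d)" if "f \<in> R" for f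
      using that R(1) unfolding bqf_double_primitive_iff by blast
    show "\<exists>g\<in>R. bqf_equiv G (bqf_double g)" if G: "G \<in> primitive_forms_disc (4*d)" for G
    proof -
      obtain g where g: "g \<in> ?P" "odd (fst g)" "bqf_equiv G (bqf_double g)"
        using bqf_double_surj[OF d4 assms(2) G] by blast
      obtain f where f: "f \<in> R" "bqf_equiv g f" using R(2) g(1) by blast
      then obtain p q r s where m: "p*s - q*r = 1" "f = bqf_act p q r s g"
        unfolding bqf_equiv_def by blast
      obtain a b c where abc: "g = (a, b, c)" by (cases g)
      have "odd a" "odd b" "even c" using parity g abc by auto
      moreover have "odd (a*p^2 + b*p*r + c*r^2)" using R(1) f(1) m(2) by (auto simp: abc bqf_act_def)
      \<comment> \<open>Modulo 2 the value of \<open>g\<close> at (p, r) is p(p + r), which is odd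
        only for odd \<open>p\<close> and even \<open>r\<close>.\<close>
      ultimately have "even r" by auto
      then have "bqf_equiv (bqf_double g) (bqf_double f)"
        unfolding m(2) by (rule bqf_double_equivI[OF m(1)])
      then show ?thesis using f(1) bqf_equiv_trans[OF g(3)] by blast
    qed
    show "f = g" if fg: "f \<in> R" "g \<in> R" "bqf_equiv (bqf_double f) (bqf_double g)" for f g
    proof -
      have "odd (fst f)" using fg(1) R(1) by blast
      from bqf_double_equivD[OF fg(3) this] have "bqf_equiv f g" unfolding bqf_equiv_def by metis
      then show ?thesis using R(3) fg by blast
    qed
  qed
  ultimately show ?thesis by simp
qed

text \<open>The subgroup in question consists of the matrices with even lower left entry \<open>r\<close>.\<close>
definition gamma0_cosets :: "(int \<times> int \<times> int \<times> int) set" where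
  "gamma0_cosets = {(1, 0, 0, 1), (0, -1, 1, 0), (1, 0, 1, 1)}"

lemma gamma0_cosets_det: "(p, q, r, s) \<in> gamma0_cosets \<Longrightarrow> p*s - q*r = 1"
  by (auto simp: gamma0_cosets_def)

text \<open>The first columns of the three matrices are the three nonzero vectors modulo 2.\<close>

lemma gamma0_cosets_cong:
  assumes "(p, q, r, s) \<in> gamma0_cosets" "(p', q', r', s') \<in> gamma0_cosets"
    "even p \<longleftrightarrow> even p'" "even r \<longleftrightarrow> even r'"
  shows "(p, q, r, s) = (p', q', r', s')"
  using assms by (auto simp: gamma0_cosets_def)

text \<open>The entry \<open>- r'*p + p'*r\<close> is the lower left one of K^(-1) M, where K is the
  representative and M the given matrix. It is even when K and M have the same first column modulo
  2.\<close>

lemma gamma0_cosets_decomp: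
  fixes p q r s :: int
  assumes "p*s - q*r = 1"
  obtains p' q' r' s' where "(p', q', r', s') \<in> gamma0_cosets" "even (- r'*p + p'*r)"
proof -
  have "odd (p*s - q*r)" unfolding assms by simp
  then have "odd p \<or> odd r" by auto
  then consider "even r" | "even p" "odd r" | "odd p" "odd r" by blast
  then show thesis
  proof cases
    case 1
    then show thesis using that[of 1 0 0 1] by (simp add: gamma0_cosets_def)
  next
    case 2
    then show thesis using that[of 0 "-1" 1 0] by (simp add: gamma0_cosets_def)
  next
    case 3
    then show thesis using that[of 1 0 1 1] by (simp add: gamma0_cosets_def)
  qed
qed

text \<open>The form is odd at all three nonzero points modulo 2, and since its automorphs are \<open>\<plusminus>1\<close>
  the three restrictions to sublattices of index two are inequivalent.\<close>
lemma h_four_mult_5_mod_8: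
  assumes "d mod 8 = 5" "d < -4"
  shows "h (4*d) = 3 * h d"
proof -
  let ?P = "primitive_forms_disc d"
  have d4: "d mod 4 = 1" using assms(1) by presburger
  have d0: "d < 0" using assms(2) by simp
  \<comment> \<open>Now b^2 - d is 4 modulo 8, so \<open>a*c\<close> is odd.\<close>
  have odd_fst: "odd (fst f)" if "f \<in> ?P" for f
  proof -
    obtain a b c where abc: "f = (a, b, c)" by (cases f)
    have e: "b^2 = 4*(a*c) + d" using that by (simp add: abc primitive_forms_disc_def)
    moreover have "odd d" using assms(1) by presburger
    ultimately have "odd (b^2)" by simp
    then have "b^2 mod 8 = 1" using odd_square_mod_8 by simp
    moreover have "odd y" if "x mod 8 = 1" "x = 4*y + d" for x y :: int
      using that assms(1) by presburger
    ultimately have "odd (a*c)" using e by blast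
    then show ?thesis by (simp add: abc)
  qed
  obtain R where R: "R \<subseteq> ?P" "\<And>f. f \<in> ?P \<Longrightarrow> \<exists>g\<in>R. bqf_equiv f g"
    "\<And>f g. f \<in> R \<Longrightarrow> g \<in> R \<Longrightarrow> bqf_equiv f g \<Longrightarrow> f = g"
    using bqf_representatives[of ?P ?P] bqf_equiv_refl by blast
  have "h d = card R" using h_eq_card[of R id d] R by auto
  define \<phi> where "\<phi> x = (case x of (f, p, q, r, s) \<Rightarrow> bqf_double (bqf_act p q r s f))"
    for x :: "bqf \<times> int \<times> int \<times> int \<times> int"
  have "h (4*d) = card (R \<times> gamma0_cosets)"
  proof (rule h_eq_card[of "R \<times> gamma0_cosets" \<phi>])
    fix x assume "x \<in> R \<times> gamma0_cosets"
    then obtain f p q r s where x: "x = (f, p, q, r, s)" "f \<in> R" "(p, q, r, s) \<in> gamma0_cosets"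
      by (cases x) auto
    have "bqf_act p q r s f \<in> ?P"
      using primitive_forms_disc_equiv[OF bqf_equivI[OF gamma0_cosets_det[OF x(3)]] d0] x(2) R(1) by blast
    then show "\<phi> x \<in> primitive_forms_disc (4*d)"
      unfolding x(1) \<phi>_def by (simp add: bqf_double_primitive_iff odd_fst)
  next
    fix G assume G: "G \<in> primitive_forms_disc (4*d)"
    obtain g where g: "g \<in> ?P" "bqf_equiv G (bqf_double g)"
      using bqf_double_surj[OF d4 d0 G] by blast
    obtain f where f: "f \<in> R" "bqf_equiv g f" using R(2) g(1) by blast
    obtain p q r s where m: "p*s - q*r = 1" "g = bqf_act p q r s f"
      using bqf_equiv_sym[OF f(2)] unfolding bqf_equiv_def by blast
    obtain p' q' r' s' where k: "(p', q', r', s') \<in> gamma0_cosets" "even (- r'*p + p'*r)"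
      using gamma0_cosets_decomp[OF m(1)] by blast
    note k_det = gamma0_cosets_det[OF k(1)]
    let ?f' = "bqf_act p' q' r' s' f"
    \<comment> \<open>This is M = K (K^(-1) M), whose second factor has even lower left entry and
      therefore respects doubling.\<close>
    have "p'*(s'*p - q'*r) + q'*(- r'*p + p'*r) = (p'*s' - q'*r')*p"
      "p'*(s'*q - q'*s) + q'*(- r'*q + p'*s) = (p'*s' - q'*r')*q"
      "r'*(s'*p - q'*r) + s'*(- r'*p + p'*r) = (p'*s' - q'*r')*r"
      "r'*(s'*q - q'*s) + s'*(- r'*q + p'*s) = (p'*s' - q'*r')*s"
      by (simp_all add: algebra_simps)
    then have "g = bqf_act (s'*p - q'*r) (s'*q - q'*s) (- r'*p + p'*r) (- r'*q + p'*s) ?f'"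
      unfolding m(2) bqf_act_act k_det by simp
    moreover have "(s'*p - q'*r) * (- r'*q + p'*s) - (s'*q - q'*s) * (- r'*p + p'*r) =
        (p'*s' - q'*r') * (p*s - q*r)"
      by (simp add: algebra_simps)
    ultimately have "bqf_equiv (bqf_double ?f') (bqf_double g)"
      using bqf_double_equivI[OF _ k(2)] unfolding k_det m(1) by simp
    then have "bqf_equiv G (\<phi> (f, p', q', r', s'))"
      unfolding \<phi>_def using bqf_equiv_trans[OF g(2)] bqf_equiv_sym by auto
    then show "\<exists>x\<in>R \<times> gamma0_cosets. bqf_equiv G (\<phi> x)" using f(1) k(1) by blast
  next
    fix x y assume xR: "x \<in> R \<times> gamma0_cosets" and yR: "y \<in> R \<times> gamma0_cosets"
      and xy: "bqf_equiv (\<phi> x) (\<phi> y)"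
    obtain f p q r s where x: "x = (f, p, q, r, s)" "f \<in> R" "(p, q, r, s) \<in> gamma0_cosets"
      using xR by (cases x) auto
    obtain g p' q' r' s' where y: "y = (g, p', q', r', s')" "g \<in> R" "(p', q', r', s') \<in> gamma0_cosets"
      using yR by (cases y) auto
    note det = gamma0_cosets_det[OF x(3)] gamma0_cosets_det[OF y(3)]
    let ?f = "bqf_act p q r s f" and ?g = "bqf_act p' q' r' s' g"
    have ff: "bqf_equiv f ?f" and gg: "bqf_equiv g ?g" using bqf_equivI det by auto
    have fP: "f \<in> ?P" using x(2) R(1) by blast
    have oddf: "odd (fst ?f)" using odd_fst primitive_forms_disc_equiv[OF ff d0 fP] by blast
    have "bqf_equiv (bqf_double ?f) (bqf_double ?g)" using xy unfolding x(1) y(1) \<phi>_def by simp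
    then obtain P Q S T where m: "P*T - Q*S = 1" "even S" "?g = bqf_act P Q S T ?f"
      by (rule bqf_double_equivD[OF _ oddf])
    have "bqf_equiv ?f ?g" using m(1) unfolding m(3) by (rule bqf_equivI)
    then have "bqf_equiv f g"
      using bqf_equiv_trans[OF bqf_equiv_trans[OF ff] bqf_equiv_sym[OF gg]] by blast
    then have fg: "g = f" using R(3) x(2) y(2) by blast
    \<comment> \<open>With K, K' the two representatives and N the matrix from \<open>m\<close>,
      these are the entries of K N. Then K N K'^(-1) is an automorph of \<open>f\<close>, hence plus
      or minus the identity.\<close>
    define m1 m2 m3 m4 where M: "m1 = p*P + q*S" "m2 = p*Q + q*T" "m3 = r*P + s*S" "m4 = r*Q + s*T"
    have mg: "?g = bqf_act m1 m2 m3 m4 f" unfolding m(3) bqf_act_act M ..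
    have "bqf_act s' (-q') (-r') p' ?g = f"
      unfolding bqf_act_act fg using det(2) by (simp add: algebra_simps)
    then have fixed: "bqf_act (m1*s' - m2*r') (m2*p' - m1*q') (m3*s' - m4*r') (m4*p' - m3*q') f = f"
      unfolding mg bqf_act_act by (simp add: algebra_simps)
    have "(m1*s' - m2*r') * (m4*p' - m3*q') - (m2*p' - m1*q') * (m3*s' - m4*r') =
        (p*s - q*r) * (P*T - Q*S) * (p'*s' - q'*r')"
      unfolding M by (simp add: algebra_simps)
    then have "(m1*s' - m2*r') * (m4*p' - m3*q') - (m2*p' - m1*q') * (m3*s' - m4*r') = 1"
      unfolding det m(1) by simp
    from bqf_primitive_automorph[OF fP assms(2) this fixed]
    obtain e where e: "e = 1 \<or> e = -1" "m1*s' - m2*r' = e" "m2*p' - m1*q' = 0"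
      "m3*s' - m4*r' = 0" "m4*p' - m3*q' = e" by blast
    \<comment> \<open>Multiplying back by K' gives K N = K' or -K', so the first columns of K N and
      K' agree modulo 2.\<close>
    have "m1 * (p'*s' - q'*r') = p'*(m1*s' - m2*r') + r'*(m2*p' - m1*q')"
      "m3 * (p'*s' - q'*r') = p'*(m3*s' - m4*r') + r'*(m4*p' - m3*q')"
      by (simp_all add: algebra_simps)
    then have "m1 = p'*e" "m3 = r'*e" unfolding det e by simp_all
    then have "even m1 \<longleftrightarrow> even p'" "even m3 \<longleftrightarrow> even r'" using e(1) by auto
    \<comment> \<open>As \<open>P\<close> is odd and \<open>S\<close> even, K N and K also have the
      same first column modulo 2.\<close>
    moreover have "odd (P*T - Q*S)" unfolding m(1) by simp
    then have "odd P" using m(2) by auto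
    then have "even m1 \<longleftrightarrow> even p" "even m3 \<longleftrightarrow> even r" unfolding M using m(2) by auto
    ultimately show "x = y"
      using gamma0_cosets_cong[OF x(3) y(3)] fg unfolding x y by simp
  qed
  also have "\<dots> = card R * 3" by (simp add: card_cartesian_product gamma0_cosets_def)
  finally show ?thesis using \<open>h d = card R\<close> by simp
qed

text \<open>For k = 3 the weight 1/3 restores the factor three: both sides equal 1.\<close>

lemma h_omega_four_mult_3_mod_8:
  assumes "k mod 8 = 3" "k > 0"
  shows "h_omega (- 4 * k) = 3 * h_omega (- k)"
proof (cases "k = 3")
  case True
  then show ?thesis by (simp add: h_omega_def h_minus_12)
next
  case False
  then have "k > 4" using assms by presburger
  moreover have "(- k) mod 8 = 5" using assms(1) by presburger
  ultimately show ?thesis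
    using h_four_mult_5_mod_8[of "- k"] by (simp add: h_omega_def)
qed

lemma h_omega_four_mult_7_mod_8:
  assumes "k mod 8 = 7" "k > 0"
  shows "h_omega (- 4 * k) = h_omega (- k)"
proof -
  have "k > 4" using assms by presburger
  moreover have "(- k) mod 8 = 1" using assms(1) by presburger
  ultimately show ?thesis
    using h_four_mult_1_mod_8[of "- k"] by (simp add: h_omega_def)
qed


subsection \<open>Hurwitz class numbers\<close>

text \<open>Uniqueness of the decomposition: \<open>f\<close> divides the square part, and the
  square of the cofactor divides the squarefree \<open>d\<close>, so the cofactor is a unit.
  Normalization fixes the sign.\<close>

lemma square_part_eq:
  fixes f d N :: int
  assumes "N = f^2 * d" "f \<ge> 1" "squarefree d"
  shows "square_part N = f"
proof -
  have d0: "d \<noteq> 0" using assms(3) by auto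
  have N0: "N \<noteq> 0" using assms d0 by simp
  have "f dvd square_part N" unfolding dvd_square_part_iff assms(1) by simp
  then obtain k where k: "square_part N = f * k" by blast
  have "(f * k)^2 dvd f^2 * d" using square_part_square_dvd[of N] unfolding k unfolding assms(1) .
  then have "k^2 dvd d" using assms(2) by (simp add: power_mult_distrib)
  then have "is_unit k" using assms(3) by (rule squarefreeD[rotated])
  then have "k = 1 \<or> k = -1" by auto
  then have "square_part N = f \<or> square_part N = - f" using k by auto
  moreover have "square_part N \<ge> 0"
    using normalize_square_part[of N] by (metis abs_ge_zero normalize_int_def)
  ultimately show ?thesis using assms(2) by auto
qed

lemma square_part_pos: "N \<noteq> 0 \<Longrightarrow> square_part (N :: int) \<ge> 1"
  using normalize_square_part[of N] square_part_0_iff[of N] unfolding normalize_int_def by linarith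

lemma squarefree_part_eq: "N = (square_part N)^2 * squarefree_part N" for N :: int
  using squarefree_decompose[of N] by (simp add: mult.commute)

lemma odd_square_mult_mod_8:
  fixes t k :: int
  assumes "odd t"
  shows "(t^2 * k) mod 8 = k mod 8"
proof -
  obtain u where "t = 2*u + 1" using assms by (rule oddE)
  then have "t^2 = 4*(u*(u+1)) + 1" by (simp add: algebra_simps power2_eq_square)
  moreover have "even (u*(u+1))" by simp
  then obtain m where "u*(u+1) = 2*m" by blast
  ultimately have "t^2 = 1 + 8*m" by simp
  then have "t^2 * k = k + 8 * (m*k)" by (simp add: algebra_simps)
  then show ?thesis by (metis mod_mult_self2)
qed

lemma square_divisor_odd:
  assumes "t^2 dvd int n" "n mod 4 \<noteq> 0"
  shows "odd t"
proof
  assume "even t"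
  then obtain u where "t = 2*u" by blast
  then have "4 * u^2 dvd int n" using assms(1) by (simp add: power_mult_distrib)
  then have "4 dvd int n" by (rule dvd_mult_left)
  then show False using assms(2) by presburger
qed

text \<open>Since 4 does not divide \<open>n\<close>, \<open>t\<close> is odd, and odd squares are 1
  modulo 8.\<close>

lemma square_divisor_mod_8:
  assumes "int n = t^2 * k" "n mod 4 \<noteq> 0"
  shows "k mod 8 = int n mod 8"
  using square_divisor_odd[of t n] odd_square_mult_mod_8[of t k] assms by simp

text \<open>With d the squarefree part of \<open>n\<close>, -d is 2 or 3 modulo 4, so -4d is
  fundamental.\<close>

lemma conductor_minus_4:
  assumes "n mod 4 = 1 \<or> n mod 4 = 2"
  shows "conductor (- (4 * int n)) = square_part (int n)"
  unfolding conductor_def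
proof (rule the_equality)
  have n0: "int n \<noteq> 0" using assms by auto
  define m d where "m = square_part (int n)" and "d = squarefree_part (int n)"
  have m: "m \<ge> 1" unfolding m_def by (rule square_part_pos[OF n0])
  have nd: "int n = m^2 * d" unfolding m_def d_def by (rule squarefree_part_eq)
  have "d mod 8 = int n mod 8" using square_divisor_mod_8[OF nd] assms by auto
  then have "(- d) mod 4 = 2 \<or> (- d) mod 4 = 3" using assms by presburger
  moreover have "squarefree (- d)" unfolding d_def by simp
  moreover have "(4 * (- d)) div 4 = - d" by (rule nonzero_mult_div_cancel_left) simp
  ultimately have "fundamental_disc (4 * (- d))" unfolding fundamental_disc_def by simp
  then show "m \<ge> 1 \<and> (\<exists>D1. fundamental_disc D1 \<and> - (4 * int n) = m^2 * D1)"
    using m nd by (intro conjI exI[of _ "4 * (- d)"]) simp_all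
next
  fix f :: int assume f: "f \<ge> 1 \<and> (\<exists>D1. fundamental_disc D1 \<and> - (4 * int n) = f^2 * D1)"
  then obtain D where D: "fundamental_disc D" "- (4 * int n) = f^2 * D" by blast
  \<comment> \<open>An odd \<open>D\<close> would force f = 2g and n = g^2 * (-D), making
    \<open>n\<close> congruent to 3 modulo 4.\<close>
  have "D mod 4 \<noteq> 1"
  proof
    assume "D mod 4 = 1"
    then have "odd D" by presburger
    have "even (f^2 * D)" unfolding D(2)[symmetric] by simp
    then have "even f" using \<open>odd D\<close> by simp
    then obtain g where g: "f = 2*g" by blast
    have "- (4 * int n) = 4 * (g^2 * D)" using D(2) unfolding g by (simp add: power_mult_distrib)
    then have n: "int n = g^2 * (- D)" unfolding mult_minus_right by linarith
    have "(- D) mod 8 = int n mod 8" using square_divisor_mod_8[OF n] assms by auto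
    then show False using \<open>D mod 4 = 1\<close> assms by presburger
  qed
  then have "D mod 4 = 0" "squarefree (D div 4)" using D(1) by (auto simp: fundamental_disc_def)
  then have d: "D = 4 * (D div 4)" "squarefree (- (D div 4))" by auto
  have "- (4 * int n) = f^2 * (4 * (D div 4))" using D(2) d(1) by metis
  then have "int n = f^2 * (- (D div 4))" by simp
  then show "f = square_part (int n)" using square_part_eq[OF _ _ d(2)] f by simp
qed

lemma conductor_minus:
  assumes "n mod 4 = 3"
  shows "conductor (- int n) = square_part (int n)"
  unfolding conductor_def
proof (rule the_equality)
  have n0: "int n \<noteq> 0" using assms by auto
  define m d where "m = square_part (int n)" and "d = squarefree_part (int n)"
  have m: "m \<ge> 1" unfolding m_def by (rule square_part_pos[OF n0])
  have nd: "int n = m^2 * d" unfolding m_def d_def by (rule squarefree_part_eq)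
  have "d mod 8 = int n mod 8" using square_divisor_mod_8[OF nd] assms by simp
  then have "(- d) mod 4 = 1" using assms by presburger
  moreover have "squarefree (- d)" unfolding d_def by simp
  ultimately have "fundamental_disc (- d)" unfolding fundamental_disc_def by simp
  then show "m \<ge> 1 \<and> (\<exists>D1. fundamental_disc D1 \<and> - int n = m^2 * D1)"
    using m nd by (intro conjI exI[of _ "- d"]) simp_all
next
  fix f :: int assume f: "f \<ge> 1 \<and> (\<exists>D1. fundamental_disc D1 \<and> - int n = f^2 * D1)"
  then obtain D where D: "fundamental_disc D" "- int n = f^2 * D" by blast
  have "odd (- int n)" using assms by presburger
  then have "odd D" unfolding D(2) by simp
  then have "D mod 4 \<noteq> 0" by presburger
  then have "squarefree (- D)" using D(1) unfolding fundamental_disc_def squarefree_minus by blast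
  moreover have "int n = f^2 * (- D)" using D(2) by simp
  ultimately show "f = square_part (int n)" using square_part_eq[of "int n" f "- D"] f by simp
qed


text \<open>Divisors of the square part are exactly the \<open>t\<close> with t^2 dividing
  \<open>n\<close>, so the sums have the same index set.\<close>

lemma hurwitz_four_mult:
  assumes "n mod 4 = 1 \<or> n mod 4 = 2"
  shows "hurwitz (4*n) = (\<Sum>t\<in>square_divisors n. h_omega (- 4 * (int n div t^2)))"
proof -
  have "n \<ge> 1" using assms by (cases n) auto
  \<comment> \<open>The division is exact, which lets \<open>div\<close> commute with the sign and
    the factor 4.\<close>
  have "(- (4 * int n)) div t^2 = - 4 * (int n div t^2)" if t: "t \<in> square_divisors n" for t
  proof -
    obtain k where k: "int n = t^2 * k" and "t \<noteq> 0" using t by (auto simp: square_divisors_def)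
    have "- (4 * int n) = t^2 * (- 4 * k)" unfolding k by simp
    then have "(- (4 * int n)) div t^2 = - 4 * k" using \<open>t \<noteq> 0\<close> by (metis nonzero_mult_div_cancel_left power_not_zero)
    moreover have "int n div t^2 = k" unfolding k using \<open>t \<noteq> 0\<close> by simp
    ultimately show ?thesis by simp
  qed
  then show ?thesis
    unfolding hurwitz_def Let_def
    by (simp add: conductor_minus_4[OF assms] dvd_square_part_iff square_divisors_def)
qed

lemma hurwitz_3_mod_4:
  assumes "n mod 4 = 3"
  shows "hurwitz n = (\<Sum>t\<in>square_divisors n. h_omega (- (int n div t^2)))"
proof -
  have "(- int n) div t^2 = - (int n div t^2)" if t: "t \<in> square_divisors n" for t
  proof -
    obtain k where k: "int n = t^2 * k" and "t \<noteq> 0" using t by (auto simp: square_divisors_def)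
    have "- int n = t^2 * (- k)" unfolding k by simp
    then have "(- int n) div t^2 = - k" using \<open>t \<noteq> 0\<close> by (metis nonzero_mult_div_cancel_left power_not_zero)
    moreover have "int n div t^2 = k" unfolding k using \<open>t \<noteq> 0\<close> by simp
    ultimately show ?thesis by simp
  qed
  then show ?thesis
    unfolding hurwitz_def Let_def
    by (simp add: conductor_minus[OF assms] dvd_square_part_iff square_divisors_def)
qed

text \<open>A discriminant is congruent to a square, hence to 0 or 1, modulo 4, whereas -k is 2 or
  3.\<close>

lemma h_omega_minus_eq_0:
  assumes "k mod 4 = 1 \<or> k mod 4 = 2"
  shows "h_omega (- k) = 0"
proof -
  have "b^2 - 4*a*c \<noteq> - k" for a b c :: int
  proof
    assume e: "b^2 - 4*a*c = - k"
    have "x mod 4 = 2 \<or> x mod 4 = 3" if "x - 4*y = - k" for x y :: int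
      using that assms by presburger
    then have "b^2 mod 4 = 2 \<or> b^2 mod 4 = 3" using e by (simp add: mult.assoc)
    moreover have "b^2 mod 4 = 0 \<or> b^2 mod 4 = 1"
    proof (cases "even b")
      case True
      then show ?thesis by (auto simp: power_mult_distrib)
    next
      case False
      then show ?thesis using odd_square_mod_8[of b] by presburger
    qed
    ultimately show False by auto
  qed
  then have "primitive_forms_disc (- k) = {}" by (auto simp: primitive_forms_disc_def)
  then have "h (- k) = 0" by (simp add: h_def bqf_classes_eq)
  moreover have "k \<noteq> 4" "k \<noteq> 3" using assms by auto
  ultimately show ?thesis by (simp add: h_omega_def)
qed

section \<open>Comparison of \<open>F\<close> and \<open>F1\<close> by the residue of
  \<open>n\<close>\<close>

theorem theorem3:
  fixes n :: nat
  assumes "n \<ge> 1" and "n mod 4 \<noteq> 0"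
  shows "(n mod 4 = 1 \<or> n mod 4 = 2 \<longrightarrow> F n - F1 n = hurwitz (4*n)) \<and>
         (n mod 8 = 3 \<longrightarrow> F n - F1 n = 2 * hurwitz n) \<and>
         (n mod 8 = 7 \<longrightarrow> F n - F1 n = 0)"
proof (intro conjI impI)
  note FF1 = F_eq[OF assms(1)] F1_eq[OF assms]
  have k_pos: "int n div t^2 > 0" and k_mod: "(int n div t^2) mod 8 = int n mod 8"
    if "t \<in> square_divisors n" for t
    using square_divisors_div(2,3)[OF assms(1) that] square_divisor_mod_8[OF _ assms(2)] by auto
  show "F n - F1 n = hurwitz (4*n)" if n: "n mod 4 = 1 \<or> n mod 4 = 2"
  proof -
    have "h_omega (- (int n div t^2)) = 0" if "t \<in> square_divisors n" for t
    proof (rule h_omega_minus_eq_0)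
      have "k mod 4 = 1 \<or> k mod 4 = 2" if "k mod 8 = int n mod 8" for k
        using that n by presburger
      then show "(int n div t^2) mod 4 = 1 \<or> (int n div t^2) mod 4 = 2" using k_mod[OF that] .
    qed
    then show ?thesis unfolding FF1 hurwitz_four_mult[OF n] by simp
  qed
  show "F n - F1 n = 2 * hurwitz n" if n: "n mod 8 = 3"
  proof -
    have n8: "int n mod 8 = 3" using n by presburger
    have "h_omega (- 4 * (int n div t^2)) = 3 * h_omega (- (int n div t^2))"
      if "t \<in> square_divisors n" for t
      using k_mod[OF that] k_pos[OF that] n8 by (intro h_omega_four_mult_3_mod_8) simp_all
    \<comment> \<open>The factor 3 holds term by term, so the difference is twice
      \<open>F1 n\<close>.\<close>
    then have "F n = 3 * F1 n" unfolding FF1 sum_distrib_left by (rule sum.cong[OF refl])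
    moreover have "n mod 4 = 3" using n by presburger
    then have "F1 n = hurwitz n" unfolding FF1 by (rule hurwitz_3_mod_4[symmetric])
    ultimately show ?thesis by simp
  qed
  show "F n - F1 n = 0" if n: "n mod 8 = 7"
  proof -
    have n8: "int n mod 8 = 7" using n by presburger
    have "h_omega (- 4 * (int n div t^2)) = h_omega (- (int n div t^2))"
      if "t \<in> square_divisors n" for t
      using k_mod[OF that] k_pos[OF that] n8 by (intro h_omega_four_mult_7_mod_8) simp_all
    then have "F n = F1 n" unfolding FF1 by (rule sum.cong[OF refl])
    then show ?thesis by simp
  qed
qed

end
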